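(* Let $a$, $b$, $\ell$ be pairwise coprime non-zero integers, where $\ell=2^{\beta}d$ is a positive integer with $d$ an odd positive integer and $\beta\ge 0$. Let $\gamma\ge 0$ be an integer such that $2^{\gamma}\,\|\,a+b$. Then $\ell\in G_{(a,b)}$ if and only if one of the following statements holds: 1. $\ell\in\{1,2\}$; 2. $d=1$ and $2\le\beta\le\gamma$; 3. $d\ge 3$, $\beta\in\{0,1\}$, and there exists an integer $s\ge 1$ such that $2^s\,\|\,\mathrm{Ord}_p(ab^{-1})$ for every prime $p$ dividing $d$; 4. $d\ge 3$, $2\le\beta\le\gamma$ and $2\,\|\,\mathrm{Ord}_p(ab^{-1})$ for every prime $p$ dividing $d$. Moreover, in cases 3 and 4, if $\ell\in G_{(a,b)}$, then for every integer $s\ge 1$: $2^s\,\|\,\mathrm{Ord}_{\ell}(ab^{-1})$ if and only if $2^s\,\|\,\mathrm{Ord}_p(ab^{-1})$ for every prime $p$ dividing $d$.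
   Context: For coprime nonzero integers $a,b$, a positive integer $\ell$ is called good (with respect to $a$ and $b$) if there exists a positive integer $k$ such that $\ell\mid a^k+b^k$; $G_{(a,b)}$ denotes the set of all good integers with respect to $a$ and $b$. Here $b^{-1}$ denotes the multiplicative inverse of $b$ modulo $\ell$, and for a divisor $m$ of $\ell$, $\mathrm{Ord}_m(ab^{-1})$ denotes the multiplicative order of $ab^{-1}$ modulo $m$. The notation $2^{\gamma}\,\|\,n$ means that $\gamma$ is the largest integer such that $2^{\gamma}\mid n$ (in particular, the hypothesis $2^\gamma\,\|\,a+b$ entails $a+b\neq 0$). *)

theory Defs
  imports "HOL-Number_Theory.Number_Theory"
begin

definition good_integers :: "int \<Rightarrow> int \<Rightarrow> int set" where
  "good_integers a b = {l. l > 0 \<and> (\<exists>k::nat. k > 0 \<and> l dvd a ^ k + b ^ k)}"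

(* Unlike multiplicity 2 n = k, this is false for n = 0, where no largest exponent exists. *)
definition exact_pow2 :: "nat \<Rightarrow> 'a::comm_semiring_1 \<Rightarrow> bool" where
  "exact_pow2 k n \<longleftrightarrow> 2 ^ k dvd n \<and> (\<forall>j. 2 ^ j dvd n \<longrightarrow> j \<le> k)"

end

theory Submission
  imports Defs
begin

text \<open>
  Put \<open>x = a b\<inverse>\<close> modulo \<open>l\<close>. Then \<open>l\<close> divides \<open>a ^ k + b ^ k\<close> iff \<open>x ^ k \<equiv> - 1\<close>
  modulo \<open>l\<close>, and the same holds for each divisor of \<open>l\<close>. Everything rests on the
  2-adic valuations of \<open>k\<close> and of the orders of \<open>x\<close>.

  If \<open>x ^ k \<equiv> - 1\<close> modulo \<open>n > 2\<close>, then the order of \<open>x\<close> divides \<open>2 * k\<close> but not \<open>k\<close>, so its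
  2-adic valuation is that of \<open>k\<close> plus one (lemma \<open>exact_pow2_ord_of_minus_one_power\<close>).
  The valuation of \<open>k\<close> does not mention \<open>n\<close>. For \<open>d \<ge> 3\<close>, applied to \<open>l\<close> and to every prime
  divisor of \<open>d\<close>, this shows that a good \<open>l\<close> forces one common valuation, which is the valuation of the
  order modulo \<open>l\<close> as well; this is the final assertion of the theorem.

  Conversely, a common valuation \<open>s \<ge> 1\<close> yields for each prime \<open>p\<close> dividing \<open>d\<close> an exponent
  \<open>2 ^ (s - 1) * m\<close> with \<open>m\<close> odd at which \<open>x\<close> becomes \<open>- 1\<close> modulo \<open>p\<close>. Odd powers preserve
  \<open>- 1\<close>, so exponents with the same power of two can be merged, and raising to the power \<open>p\<close>
  gains one more factor \<open>p\<close> in the modulus. Induction over the prime factorisation of \<open>d\<close>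
  then gives an exponent for \<open>d\<close> (lemma \<open>exists_minus_one_power\<close>).

  The factor \<open>2 ^ \<beta>\<close> imposes nothing for \<open>\<beta> \<le> 1\<close>, as \<open>a\<close> and \<open>b\<close> are odd when \<open>l\<close> is even. For \<open>\<beta> \<ge> 2\<close> it forces \<open>k\<close> to be odd, since
  \<open>a\<close> and \<open>b\<close> are odd and a sum of two odd squares is 2 modulo 4; and for odd \<open>k\<close> the quotient of \<open>a ^ k + b ^ k\<close> by
  \<open>a + b\<close> is odd, so the condition becomes \<open>\<beta> \<le> \<gamma>\<close>. An odd \<open>k\<close> is also why the common
  valuation must then be 1.
\<close>

section \<open>Exact powers of two\<close>

lemma exact_pow2_unique: "exact_pow2 s n \<Longrightarrow> exact_pow2 t n \<Longrightarrow> s = t"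
  by (auto simp: exact_pow2_def intro: antisym)

lemma dvd_iff_le_of_exact_pow2: "exact_pow2 s n \<Longrightarrow> 2 ^ j dvd n \<longleftrightarrow> j \<le> s"
  unfolding exact_pow2_def using le_imp_power_dvd dvd_trans by blast

lemma exact_pow2_iff_odd_cofactor:
  "exact_pow2 s (n::nat) \<longleftrightarrow> (\<exists>m. odd m \<and> n = 2 ^ s * m)"
proof
  assume n: "exact_pow2 s n"
  then obtain m where m: "n = 2 ^ s * m"
    by (auto simp: exact_pow2_def)
  have "\<not> 2 ^ Suc s dvd n"
    using dvd_iff_le_of_exact_pow2[OF n, of "Suc s"] by simp
  with m show "\<exists>m. odd m \<and> n = 2 ^ s * m"
    by auto
next
  assume "\<exists>m. odd m \<and> n = 2 ^ s * m"
  then obtain m where m: "odd m" "n = 2 ^ s * m"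
    by blast
  have "j \<le> s" if "2 ^ j dvd n" for j
  proof (rule ccontr)
    assume "\<not> j \<le> s"
    then have "2 ^ Suc s dvd n"
      using that by (meson dvd_trans le_imp_power_dvd not_less_eq_eq)
    with m show False
      by simp
  qed
  with m show "exact_pow2 s n"
    by (auto simp: exact_pow2_def)
qed

lemma exact_pow2_exists:
  assumes "(n::nat) > 0"
  obtains s where "exact_pow2 s n"
proof -
  obtain m where "n = 2 ^ multiplicity 2 n * m" "odd m"
    using assms by (auto intro: multiplicity_decompose'[of n 2])
  then show thesis
    using that exact_pow2_iff_odd_cofactor by blast
qed

text \<open>
  A divisor of \<open>2 * k\<close> whose valuation is at most that of \<open>k\<close> divides \<open>k\<close>, because its odd
  part divides the odd part of \<open>k\<close>. Failing to divide \<open>k\<close> therefore pins down the valuation.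
\<close>
lemma exact_pow2_Suc_of_dvd_double:
  fixes k n :: nat
  assumes "exact_pow2 t k" and "n dvd 2 * k" and "\<not> n dvd k"
  shows "exact_pow2 (Suc t) n"
proof -
  obtain m where m: "odd m" "k = 2 ^ t * m"
    using assms(1) exact_pow2_iff_odd_cofactor by blast
  have dvd: "n dvd 2 ^ Suc t * m"
    using assms(2) m by (simp add: mult.assoc)
  have "n > 0"
    using dvd m by (intro Nat.gr0I) auto
  then obtain u where "exact_pow2 u n"
    by (rule exact_pow2_exists)
  then obtain w where w: "odd w" "n = 2 ^ u * w"
    using exact_pow2_iff_odd_cofactor by blast
  have "w dvd 2 ^ Suc t * m" "2 ^ u dvd 2 ^ Suc t * m"
    using dvd w by (metis dvd_mult_right, metis dvd_mult_left)
  moreover have "coprime w (2 ^ Suc t)"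
    using w by simp
  ultimately have "w dvd m"
    using coprime_dvd_mult_right_iff by blast
  have "exact_pow2 (Suc t) (2 ^ Suc t * m)"
    using m exact_pow2_iff_odd_cofactor by blast
  then have "u \<le> Suc t"
    using \<open>2 ^ u dvd 2 ^ Suc t * m\<close> dvd_iff_le_of_exact_pow2 by blast
  moreover have "\<not> u \<le> t"
    using assms(3) m w \<open>w dvd m\<close> by (auto simp: le_imp_power_dvd mult_dvd_mono)
  ultimately have "u = Suc t"
    by simp
  with \<open>exact_pow2 u n\<close> show ?thesis
    by simp
qed

section \<open>Orders of integers and powers congruent to minus one\<close>

text \<open>
  The order of an integer is the order of its residue, a natural number, so the divisibility
  criterion for natural numbers carries over.
\<close>
lemma ord_dvd_iff_int:
  fixes n x :: int
  assumes "n > 0"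
  shows "ord n x dvd k \<longleftrightarrow> [x ^ k = 1] (mod n)"
proof -
  define y where "y = nat (x mod n)"
  have y: "[x = int y] (mod n)" and n: "int (nat n) = n"
    using assms by (simp_all add: y_def)
  have pow: "[x ^ j = 1] (mod n) \<longleftrightarrow> [y ^ j = 1] (mod nat n)" for j
  proof -
    have "[x ^ j = 1] (mod n) \<longleftrightarrow> [int y ^ j = 1] (mod n)"
      using cong_pow[OF y, of j] cong_sym cong_trans by blast
    also have "\<dots> \<longleftrightarrow> [int (y ^ j) = int 1] (mod int (nat n))"
      using n by simp
    also have "\<dots> \<longleftrightarrow> [y ^ j = 1] (mod nat n)"
      by (rule cong_int_iff)
    finally show ?thesis .
  qed
  have "coprime n x \<longleftrightarrow> coprime n (int y)"
    using y by (metis cong_imp_coprime cong_sym coprime_commute)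
  also have "\<dots> \<longleftrightarrow> coprime (nat n) y"
    by (metis n coprime_int_iff)
  finally have "ord n x = ord (nat n) y"
    by (simp add: ord_def pow)
  then show ?thesis
    by (simp only: pow ord_divides)
qed

text \<open>
  The valuation of the order depends on \<open>k\<close> alone and not on the modulus, which makes
  orders for different moduli comparable. The bound excludes moduli with \<open>1 \<equiv> - 1\<close>.
\<close>
lemma exact_pow2_ord_of_minus_one_power:
  fixes n x :: int
  assumes "n > 2" and "n dvd x ^ k + 1" and "exact_pow2 t k"
  shows "exact_pow2 (Suc t) (ord n x)"
proof (rule exact_pow2_Suc_of_dvd_double[OF assms(3)])
  have "x ^ (2 * k) - 1 = (x ^ k + 1) * (x ^ k - 1)"
    by (simp add: algebra_simps power_mult power2_eq_square power_mult_distrib mult_2 power_add)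
  then show "ord n x dvd 2 * k"
    using assms by (simp add: ord_dvd_iff_int cong_iff_dvd_diff)
  show "\<not> ord n x dvd k"
  proof
    assume "ord n x dvd k"
    then have "n dvd x ^ k - 1"
      using assms by (simp add: ord_dvd_iff_int cong_iff_dvd_diff)
    then have "n dvd (x ^ k + 1) - (x ^ k - 1)"
      using assms(2) by (rule dvd_diff[rotated])
    then show False
      using assms(1) by (auto dest: zdvd_imp_le)
  qed
qed

text \<open>Modulo a prime, the only square root of 1 other than 1 is \<open>- 1\<close>.\<close>
lemma minus_one_power_of_exact_pow2_ord:
  fixes p x :: int
  assumes "prime p" and "exact_pow2 (Suc t) (ord p x)"
  obtains m where "odd m" and "p dvd x ^ (2 ^ t * m) + 1"
proof -
  have p0: "p > 0"
    using assms(1) by (simp add: prime_gt_0_int)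
  obtain m where m: "odd m" "ord p x = 2 ^ Suc t * m"
    using assms(2) exact_pow2_iff_odd_cofactor by blast
  let ?y = "x ^ (2 ^ t * m)"
  have "ord p x = 2 ^ t * m + 2 ^ t * m"
    using m by simp
  then have "?y * ?y - 1 = x ^ ord p x - 1"
    by (simp only: power_add)
  then have "p dvd ?y * ?y - 1"
    using ord_dvd_iff_int[OF p0, of x "ord p x"] by (simp add: cong_iff_dvd_diff)
  then have "p dvd (?y - 1) * (?y + 1)"
    by (simp add: algebra_simps)
  moreover have "\<not> p dvd ?y - 1"
  proof
    assume "p dvd ?y - 1"
    then have "2 ^ Suc t * m dvd 2 ^ t * m"
      using ord_dvd_iff_int[OF p0, of x] m by (simp add: cong_iff_dvd_diff)
    then show False
      using m by (auto dest: dvd_imp_le simp: odd_pos)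
  qed
  ultimately have "p dvd ?y + 1"
    using assms(1) prime_dvd_mult_iff by blast
  with m show thesis
    using that by blast
qed

section \<open>Odd powers\<close>

text \<open>
  Modulo \<open>a + b\<close> one has \<open>b \<equiv> - a\<close>, which makes all \<open>k\<close> terms of the quotient equal to
  \<open>a ^ (k - 1)\<close>. This serves twice: the quotient gains a factor \<open>p\<close> when \<open>k = p\<close> divides
  \<open>a + b\<close>, and it is odd when \<open>a\<close> and \<open>b\<close> are.
\<close>
lemma odd_power_sum_factor:
  fixes a b :: int
  assumes "odd k"
  obtains S where "a ^ k + b ^ k = (a + b) * S" and "[S = int k * a ^ (k - 1)] (mod (a + b))"
proof
  let ?S = "\<Sum>i<k. (- b) ^ (k - Suc i) * a ^ i"
  show "a ^ k + b ^ k = (a + b) * ?S"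
    using power_diff_sumr2[of a k "- b"] assms by simp
  have b: "[- b = a] (mod (a + b))"
    by (simp add: cong_iff_dvd_diff dvd_diff_commute)
  have "[?S = (\<Sum>i<k. a ^ (k - 1))] (mod (a + b))"
  proof (rule cong_sum)
    fix i assume "i \<in> {..<k}"
    then have "k - 1 = (k - Suc i) + i"
      by simp
    then have "a ^ (k - 1) = a ^ (k - Suc i) * a ^ i"
      by (metis power_add)
    then show "[(- b) ^ (k - Suc i) * a ^ i = a ^ (k - 1)] (mod (a + b))"
      using cong_mult[OF cong_pow[OF b] cong_refl] by metis
  qed
  then show "[?S = int k * a ^ (k - 1)] (mod (a + b))"
    by simp
qed

lemma dvd_odd_power_plus_one:
  fixes m y :: int
  assumes "m dvd y + 1" and "odd k"
  shows "m dvd y ^ k + 1"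
  using odd_power_sum_factor[OF assms(2), of y 1] assms(1) by (metis dvd_mult2 power_one)

text \<open>
  Lifting the exponent: the induction adds the prime factors of \<open>d\<close> one by one, counted
  with multiplicity, and \<open>p\<close> may or may not divide \<open>d\<close> already. The last power \<open>p\<close> is what
  turns the two separate divisibilities by \<open>d\<close> and \<open>p\<close> into divisibility by \<open>p * d\<close>.
\<close>
lemma exists_minus_one_power:
  fixes d x :: int
  assumes "odd d"
    and "\<And>p. prime p \<Longrightarrow> p dvd d \<Longrightarrow> exact_pow2 (Suc t) (ord p x)"
  shows "\<exists>m. odd m \<and> d dvd x ^ (2 ^ t * m) + 1"
  using assms
proof (induction d rule: prime_divisors_induct)
  case zero
  then show ?case by simp
next
  case (unit d)
  then show ?case
    using unit_imp_dvd odd_one by blast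
next
  case (factor p d)
  obtain m where m: "odd m" "d dvd x ^ (2 ^ t * m) + 1"
    using factor by auto
  obtain n where n: "odd n" "p dvd x ^ (2 ^ t * n) + 1"
    using minus_one_power_of_exact_pow2_ord[of p t x] factor by auto
  define y where "y = x ^ (2 ^ t * (m * n))"
  have "y = (x ^ (2 ^ t * m)) ^ n" "y = (x ^ (2 ^ t * n)) ^ m"
    by (simp_all add: y_def mult_ac flip: power_mult)
  then have y: "d dvd y + 1" "p dvd y + 1"
    using m n dvd_odd_power_plus_one by metis+
  define q where "q = nat p"
  have q: "int q = p"
    using factor by (simp add: q_def prime_ge_0_int)
  have "odd (int q)"
    using factor.prems q by simp
  then have "odd q"
    by simp
  then obtain S where S: "y ^ q + 1 ^ q = (y + 1) * S"
      "[S = int q * y ^ (q - 1)] (mod (y + 1))"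
    using odd_power_sum_factor by blast
  have "[S = int q * y ^ (q - 1)] (mod p)"
    using S(2) y(2) cong_dvd_modulus by blast
  then have "p dvd S"
    using q by (simp add: cong_dvd_iff)
  then have "p * d dvd y ^ q + 1"
    using S(1) mult_dvd_mono[OF y(1) \<open>p dvd S\<close>] by (simp add: mult.commute)
  moreover have "y ^ q = x ^ (2 ^ t * (m * n * q))"
    by (simp add: y_def mult_ac flip: power_mult)
  ultimately show ?case
    using m n \<open>odd q\<close> by (intro exI[of _ "m * n * q"]) simp
qed

section \<open>Powers of two dividing a sum of powers\<close>

lemma pow2_dvd_odd_power_sum_iff:
  fixes a b :: int
  assumes "odd a" and "odd b" and "odd k"
  shows "2 ^ j dvd a ^ k + b ^ k \<longleftrightarrow> 2 ^ j dvd a + b"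
proof -
  obtain S where S: "a ^ k + b ^ k = (a + b) * S" "[S = int k * a ^ (k - 1)] (mod (a + b))"
    using odd_power_sum_factor[OF assms(3)] by blast
  have "even (a + b)"
    using assms by simp
  then have "[S = int k * a ^ (k - 1)] (mod 2)"
    using S(2) cong_dvd_modulus by blast
  then have "odd S"
    using assms by (simp add: cong_dvd_iff)
  then have "coprime (2 ^ j) S"
    by simp
  then show ?thesis
    by (simp add: S(1) coprime_dvd_mult_left_iff)
qed

text \<open>A sum of two odd squares is 2 modulo 4.\<close>
lemma odd_exponent_of_four_dvd:
  fixes a b :: int
  assumes "odd a" and "odd b" and "4 dvd a ^ k + b ^ k"
  shows "odd k"
proof
  assume "even k"
  then obtain j where j: "k = 2 * j" ..
  have "odd (a ^ j)" "odd (b ^ j)"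
    using assms by simp_all
  then obtain u v where "a ^ j = 2 * u + 1" "b ^ j = 2 * v + 1"
    by (metis oddE)
  then have "a ^ k + b ^ k = 4 * (u * u + u + v * v + v) + 2"
    by (simp add: j mult.commute[of 2 j] power_mult power2_eq_square algebra_simps)
  with assms(3) show False
    by presburger
qed

section \<open>Good integers\<close>

text \<open>Multiplying \<open>x ^ k + 1\<close> by the unit \<open>b ^ k\<close> gives \<open>a ^ k + b ^ k\<close>.\<close>
lemma dvd_power_sum_iff_minus_one_power:
  fixes a b l m :: int
  assumes "coprime b l" and "m dvd l"
  shows "m dvd a ^ k + b ^ k \<longleftrightarrow> m dvd (a * modular_inverse l b) ^ k + 1"
proof -
  let ?x = "a * modular_inverse l b"
  have "[modular_inverse l b * b = 1] (mod m)"
    using cong_modular_inverse2[OF assms(1)] assms(2) cong_dvd_modulus by blast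
  then have "[a * (modular_inverse l b * b) = a * 1] (mod m)"
    by (intro cong_mult cong_refl)
  then have "[?x * b = a] (mod m)"
    by (simp add: mult.assoc)
  then have "[(?x * b) ^ k + b ^ k = a ^ k + b ^ k] (mod m)"
    by (intro cong_add cong_pow cong_refl)
  then have "m dvd a ^ k + b ^ k \<longleftrightarrow> m dvd (?x * b) ^ k + b ^ k"
    by (simp add: cong_dvd_iff)
  also have "(?x * b) ^ k + b ^ k = (?x ^ k + 1) * b ^ k"
    by (simp add: power_mult_distrib algebra_simps)
  also have "coprime m (b ^ k)"
    using assms coprime_divisors[of b b m l] by (simp add: coprime_commute)
  then have "m dvd (?x ^ k + 1) * b ^ k \<longleftrightarrow> m dvd ?x ^ k + 1"
    by (rule coprime_dvd_mult_left_iff)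
  finally show ?thesis .
qed

theorem corollary1:
  fixes a b l d :: int and \<beta> \<gamma> :: nat
  assumes "a \<noteq> 0" and "b \<noteq> 0"
    and "coprime a b" and "coprime a l" and "coprime b l"
    and "l = 2 ^ \<beta> * d" and "d > 0" and "odd d"
    and "exact_pow2 \<gamma> (a + b)"
  shows "(l \<in> good_integers a b \<longleftrightarrow>
      l \<in> {1, 2}
    \<or> (d = 1 \<and> 2 \<le> \<beta> \<and> \<beta> \<le> \<gamma>)
    \<or> (d \<ge> 3 \<and> \<beta> \<in> {0, 1} \<and>
        (\<exists>s::nat. s \<ge> 1 \<and>
          (\<forall>p::int. prime p \<longrightarrow> p dvd d \<longrightarrow> exact_pow2 s (ord p (a * modular_inverse l b)))))
    \<or> (d \<ge> 3 \<and> 2 \<le> \<beta> \<and> \<beta> \<le> \<gamma> \<and>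
        (\<forall>p::int. prime p \<longrightarrow> p dvd d \<longrightarrow> exact_pow2 1 (ord p (a * modular_inverse l b)))))
  \<and>
    ((d \<ge> 3 \<and> \<beta> \<in> {0, 1} \<and>
        (\<exists>s::nat. s \<ge> 1 \<and>
          (\<forall>p::int. prime p \<longrightarrow> p dvd d \<longrightarrow> exact_pow2 s (ord p (a * modular_inverse l b)))))
     \<or> (d \<ge> 3 \<and> 2 \<le> \<beta> \<and> \<beta> \<le> \<gamma> \<and>
        (\<forall>p::int. prime p \<longrightarrow> p dvd d \<longrightarrow> exact_pow2 1 (ord p (a * modular_inverse l b))))
     \<longrightarrow> l \<in> good_integers a b
     \<longrightarrow> (\<forall>s::nat. s \<ge> 1 \<longrightarrow>
           (exact_pow2 s (ord l (a * modular_inverse l b)) \<longleftrightarrow>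
            (\<forall>p::int. prime p \<longrightarrow> p dvd d \<longrightarrow> exact_pow2 s (ord p (a * modular_inverse l b))))))"
proof -
  define x where "x = a * modular_inverse l b"
  define P where "P s \<longleftrightarrow> (\<forall>p::int. prime p \<longrightarrow> p dvd d \<longrightarrow> exact_pow2 s (ord p x))" for s
  note x_iff = dvd_power_sum_iff_minus_one_power[OF \<open>coprime b l\<close>, where a = a, folded x_def]
  have l: "l = 2 ^ \<beta> * d" and d: "d > 0" "odd d"
    using assms by auto
  have "l > 0" "d dvd l"
    using l d by auto
  have odd_ab: "odd a" "odd b" if "\<beta> \<ge> 1"
  proof -
    have "even l"
      using that l by simp
    then show "odd a" "odd b"
      using coprime_common_divisor[OF assms(4), of 2]
        coprime_common_divisor[OF assms(5), of 2] by auto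
  qed
  have pow2_iff: "2 ^ \<beta> dvd a ^ k + b ^ k \<longleftrightarrow> \<beta> \<le> \<gamma>" if "odd k" "\<beta> \<ge> 1" for k
    using pow2_dvd_odd_power_sum_iff[OF odd_ab that(1)] that(2)
      dvd_iff_le_of_exact_pow2[OF assms(9)] by simp
  have l_dvd_iff: "l dvd n \<longleftrightarrow> 2 ^ \<beta> dvd n \<and> d dvd n" for n
    using d by (auto simp: l intro: divides_mult dest: dvd_mult_left dvd_mult_right)

  have orders: "P (Suc t)" "l > 2 \<Longrightarrow> exact_pow2 (Suc t) (ord l x)"
    if "l dvd a ^ k + b ^ k" "exact_pow2 t k" for k t
  proof -
    have *: "exact_pow2 (Suc t) (ord n x)" if "n > 2" "n dvd l" for n
      using exact_pow2_ord_of_minus_one_power[OF \<open>n > 2\<close> _ \<open>exact_pow2 t k\<close>]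
        x_iff[OF \<open>n dvd l\<close>] \<open>l dvd a ^ k + b ^ k\<close> \<open>n dvd l\<close> dvd_trans by blast
    show "P (Suc t)"
      unfolding P_def
    proof (intro allI impI)
      fix p :: int
      assume p: "prime p" "p dvd d"
      then have "p \<noteq> 2"
        using d by auto
      then have "p > 2"
        using prime_ge_2_int[OF p(1)] by simp
      then show "exact_pow2 (Suc t) (ord p x)"
        using p \<open>d dvd l\<close> by (intro *) (auto intro: dvd_trans)
    qed
    show "exact_pow2 (Suc t) (ord l x)" if "l > 2"
      using that by (intro *) auto
  qed

  have P_unique: "s = t" if "d \<ge> 3" "P s" "P t" for s t
  proof -
    obtain p :: int where "prime p" "p dvd d"
      using prime_divisor_exists[of d] \<open>d \<ge> 3\<close> by auto
    then show ?thesis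
      using that exact_pow2_unique unfolding P_def by blast
  qed

  have good_iff: "l \<in> good_integers a b \<longleftrightarrow>
      l \<in> {1, 2}
    \<or> (d = 1 \<and> 2 \<le> \<beta> \<and> \<beta> \<le> \<gamma>)
    \<or> (d \<ge> 3 \<and> \<beta> \<in> {0, 1} \<and> (\<exists>s::nat. s \<ge> 1 \<and> P s))
    \<or> (d \<ge> 3 \<and> 2 \<le> \<beta> \<and> \<beta> \<le> \<gamma> \<and> P 1)" (is "_ \<longleftrightarrow> ?C1 \<or> ?C2 \<or> ?C3 \<or> ?C4")
  proof
    assume "l \<in> good_integers a b"
    then obtain k where k: "k > 0" "l dvd a ^ k + b ^ k"
      by (auto simp: good_integers_def)
    obtain t where t: "exact_pow2 t k"
      using exact_pow2_exists[OF k(1)] .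
    note Pt = orders(1)[OF k(2) t]
    have d_cases: "d = 1 \<or> d \<ge> 3"
      using d by presburger
    show "?C1 \<or> ?C2 \<or> ?C3 \<or> ?C4"
    proof (cases "\<beta> \<ge> 2")
      case True
      have "2 ^ 2 dvd (2::int) ^ \<beta>"
        using True by (rule le_imp_power_dvd)
      then have "4 dvd a ^ k + b ^ k"
        using k(2) l_dvd_iff dvd_trans by auto
      then have "odd k"
        using odd_exponent_of_four_dvd odd_ab True by auto
      then have "exact_pow2 0 k"
        by (simp add: exact_pow2_iff_odd_cofactor)
      then have "t = 0"
        using t exact_pow2_unique by blast
      moreover have "\<beta> \<le> \<gamma>"
        using pow2_iff[OF \<open>odd k\<close>] k(2) l_dvd_iff True by simp
      ultimately show ?thesis
        using d_cases True Pt by auto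
    next
      case False
      then have \<beta>: "\<beta> \<in> {0, 1}"
        by auto
      show ?thesis
        using d_cases
      proof
        assume "d = 1"
        with \<beta> show ?thesis
          using l by auto
      next
        assume "d \<ge> 3"
        moreover have "\<exists>s::nat. s \<ge> 1 \<and> P s"
          using Pt by (intro exI[of _ "Suc t"]) simp
        ultimately show ?thesis
          using \<beta> by blast
      qed
    qed
  next
    have good: "l \<in> good_integers a b" if "k > 0" "l dvd a ^ k + b ^ k" for k
      using that \<open>l > 0\<close> by (auto simp: good_integers_def)
    have d_dvd: "\<exists>m. odd m \<and> d dvd a ^ (2 ^ t * m) + b ^ (2 ^ t * m)" if "P (Suc t)" for t
      using exists_minus_one_power[of d t x] that d x_iff[OF \<open>d dvd l\<close>] unfolding P_def by blast
    have small: "2 ^ \<beta> dvd a ^ k + b ^ k" if "\<beta> \<in> {0, 1}" for k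
      using that odd_ab by auto
    assume "?C1 \<or> ?C2 \<or> ?C3 \<or> ?C4"
    then consider ?C1 | ?C2 | ?C3 | ?C4
      by blast
    then show "l \<in> good_integers a b"
    proof cases
      case 1
      have "\<beta> \<ge> 1" if "l = 2"
        using that l d by (cases \<beta>) auto
      then have "l dvd a ^ 1 + b ^ 1"
        using 1 odd_ab by auto
      then show ?thesis
        by (rule good[rotated]) simp
    next
      case 2
      then have "l dvd a ^ 1 + b ^ 1"
        using pow2_iff[of 1] l by simp
      then show ?thesis
        by (rule good[rotated]) simp
    next
      case 3
      then obtain t where "P (Suc t)"
        by (metis Suc_le_D One_nat_def)
      then obtain m where "odd m" "d dvd a ^ (2 ^ t * m) + b ^ (2 ^ t * m)"
        using d_dvd by blast
      then show ?thesis
        using small 3 l_dvd_iff by (intro good[of "2 ^ t * m"]) (auto simp: odd_pos)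
    next
      case 4
      then obtain m where "odd m" "d dvd a ^ m + b ^ m"
        using d_dvd[of 0] by auto
      then show ?thesis
        using pow2_iff 4 l_dvd_iff by (intro good[of m]) (auto simp: odd_pos)
    qed
  qed

  have "exact_pow2 s (ord l x) \<longleftrightarrow> P s" if d3: "d \<ge> 3" and good: "l \<in> good_integers a b" for s
  proof -
    obtain k where k: "k > 0" "l dvd a ^ k + b ^ k"
      using good by (auto simp: good_integers_def)
    obtain t where t: "exact_pow2 t k"
      using exact_pow2_exists[OF k(1)] .
    have "l > 2"
      using zdvd_imp_le[OF \<open>d dvd l\<close> \<open>l > 0\<close>] d3 by simp
    then have "exact_pow2 (Suc t) (ord l x)" "P (Suc t)"
      using orders[OF k(2) t] by auto
    then show ?thesis
      using exact_pow2_unique P_unique[OF d3] by blast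
  qed
  then show ?thesis
    using good_iff unfolding P_def x_def by blast
qed

end
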